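(* Let $H=\{h_1,\ldots,h_d\}$ be a fixed finite subset of $\mathbb{N}$ with $d=|H|$. Then for every prime $p$ there exists a constant $\eta_p^H$, depending only on $p$ and $H$, such that for every small set $P$ of primes the limit below exists and $$\kappa_P^H:=\lim_{x\to\infty}\frac{1}{x}\sum_{n\leqslant x}\Lambda_P^H(n)=\prod_{p\in P}\left(1-2\eta_p^H\right).$$ Moreover, for every non-exceptional prime $p$ (with respect to $H$), $\eta_p^H=\frac{d}{p+1}$.
   Context: $\mathbb{N}=\{1,2,\ldots\}$. For a set $P$ of primes, $\lambda_P:\mathbb{N}\to\{\pm1\}$ is the completely multiplicative function with $\lambda_P(p)=-1$ if $p\in P$ and $\lambda_P(p)=1$ for primes $p\notin P$. For $H=\{h_1,\ldots,h_d\}$ (distinct elements), $\Lambda_P^H(n):=\lambda_P(n+h_1)\cdots\lambda_P(n+h_d)$. A set of natural numbers is called small if the sum of the reciprocals of its elements converges (finite sets are small). Let $\hat H:=\{h_i-h_j : h_i,h_j\in H,\ h_i\neq h_j\}$; a prime is exceptional (with respect to $H$) if it divides an element of $\hat H$, and non-exceptional otherwise. An infinite product $\prod_{n\ge1}(1-a_n)$ is the limit of its partial products $\prod_{n\le T}(1-a_n)$, $T\to\infty$; the empty product is $1$. *)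

theory Defs
  imports "HOL-Analysis.Infinite_Sum" "HOL-Computational_Algebra.Primes"
begin

text \<open>
  The lemmas following the definition show that, for a set \<open>P\<close> of primes, \<open>lambda P\<close> is the unique
  completely multiplicative function on the positive integers with value -1 at primes in \<open>P\<close> and
  value 1 at all other primes. The value at 0 is irrelevant (it is 1).
\<close>

definition lambda :: "nat set \<Rightarrow> nat \<Rightarrow> int" where
  "lambda P n = (\<Prod>p\<in>#prime_factorization n. if p \<in> P then -1 else 1)"

lemma lambda_1: "lambda P 1 = 1"
  by (simp add: lambda_def)

lemma lambda_mult: "m \<ge> 1 \<Longrightarrow> n \<ge> 1 \<Longrightarrow> lambda P (m * n) = lambda P m * lambda P n"
  by (simp add: lambda_def prime_factorization_mult)

lemma lambda_prime: "prime p \<Longrightarrow> lambda P p = (if p \<in> P then -1 else 1)"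
  by (simp add: lambda_def prime_factorization_prime)

lemma lambda_values: "lambda P n \<in> {-1, 1}"
proof -
  have "(\<Prod>p\<in>#M. if p \<in> P then -1 else 1) \<in> {-1, 1 :: int}" for M
    by (induction M) auto
  then show ?thesis
    by (simp only: lambda_def)
qed

lemma lambda_unique:
  fixes f :: "nat \<Rightarrow> int"
  assumes "f 1 = 1"
    and mult: "\<And>m n. m \<ge> 1 \<Longrightarrow> n \<ge> 1 \<Longrightarrow> f (m * n) = f m * f n"
    and prime: "\<And>p. prime p \<Longrightarrow> f p = (if p \<in> P then -1 else 1)"
    and "n \<ge> 1"
  shows "f n = lambda P n"
  using \<open>n \<ge> 1\<close>
proof (induction n rule: prime_divisors_induct)
  case zero
  then show ?case by simp
next
  case (unit x)
  then show ?case using assms(1) lambda_1 by simp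
next
  case (factor p x)
  then have "p \<ge> 1" "x \<ge> 1"
    by (auto simp: Suc_le_eq prime_gt_0_nat)
  then show ?case
    using factor mult prime lambda_mult lambda_prime by simp
qed

definition Lambda :: "nat set \<Rightarrow> nat set \<Rightarrow> nat \<Rightarrow> int" where
  "Lambda P H n = (\<Prod>h\<in>H. lambda P (n + h))"

definition small :: "nat set \<Rightarrow> bool" where
  "small A \<longleftrightarrow> (\<lambda>n. 1 / real n) summable_on A"

definition differences :: "nat set \<Rightarrow> int set" where
  "differences H = {int h - int h' | h h'. h \<in> H \<and> h' \<in> H \<and> h \<noteq> h'}"

definition exceptional :: "nat set \<Rightarrow> nat \<Rightarrow> bool" where
  "exceptional H p \<longleftrightarrow> prime p \<and> (\<exists>k\<in>differences H. int p dvd k)"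

definition mean :: "nat set \<Rightarrow> nat set \<Rightarrow> real \<Rightarrow> real" where
  "mean P H x = 1 / x * (\<Sum>n | 1 \<le> n \<and> real n \<le> x. real_of_int (Lambda P H n))"

text \<open>
  \<open>Lim\<close> is a total function, so \<open>kappa P H\<close> is meaningful only when the limit exists.
\<close>

definition kappa :: "nat set \<Rightarrow> nat set \<Rightarrow> real" where
  "kappa P H = Lim at_top (mean P H)"

text \<open>
  The value of an infinite product is the plain limit of its partial products. Unlike with the
  library's \<open>has_prod\<close>, the limit may be 0 even if no factor vanishes, and finitely many factors
  may vanish.
\<close>

definition product_over :: "nat set \<Rightarrow> (nat \<Rightarrow> real) \<Rightarrow> real \<Rightarrow> bool" where
  "product_over P f c \<longleftrightarrow> (\<lambda>T. \<Prod>p | p \<in> P \<and> p \<le> T. f p) \<longlonglongrightarrow> c"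

end

theory Submission imports Defs "HOL-Number_Theory.Cong"
begin

text \<open>
  The correlation \<open>Lambda P H\<close> is a limit of periodic functions, and its mean value is computed
  along such an approximation, in two stages.

  For a single prime \<open>p\<close>, the sign \<open>lambda {p} n = (-1) ^ multiplicity p n\<close> depends only on the
  residue of \<open>n\<close> modulo \<open>p ^ K\<close> unless \<open>p ^ K\<close> divides \<open>n\<close>. Replacing it by 1 on the multiples of
  \<open>p ^ K\<close> therefore makes it periodic with period \<open>p ^ K\<close>, and alters the correlation only on a
  set of density at most \<open>card H / p ^ K\<close>. The correlation for a finite set \<open>F\<close> of primes is the
  product of those for the single primes; the periods \<open>p ^ K\<close> being pairwise coprime, the Chinese
  remainder theorem shows that the mean of the product of the periodic functions is the product of
  their means (\<open>periodic_mult_has_mean\<close>). Letting \<open>K\<close> tend to infinity, the mean for \<open>F\<close> is the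
  product of the means for the primes in \<open>F\<close> (\<open>finite_Lambda_has_mean\<close>), so \<open>\<eta> p\<close> has to be
  chosen such that \<open>1 - 2 * \<eta> p\<close> is the mean for \<open>p\<close> alone.

  For a small set \<open>P\<close>, omitting the primes above \<open>T\<close> alters the correlation only at those \<open>n\<close> for
  which such a prime divides some \<open>n + h\<close>; their upper density is at most \<open>card H\<close> times the tail
  of the convergent series of reciprocals. Both limits are instances of one principle: if the
  averages of \<open>g k\<close> approximate those of \<open>f\<close> uniformly, then the mean of \<open>f\<close> is the limit of the
  means of the \<open>g k\<close> (\<open>has_mean_uniform_limit\<close>).

  If \<open>p\<close> is not exceptional, at most one of the numbers \<open>n + h\<close> is divisible by \<open>p\<close>, and the
  correlation is an affine combination of shifts of \<open>lambda {p}\<close>. The mean of \<open>lambda {p}\<close> is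
  determined by its behaviour on the multiples of \<open>p\<close>, where \<open>lambda {p} (p * n) = - lambda {p} n\<close>.
\<close>

section \<open>Mean values of arithmetic functions\<close>

definition average :: "(nat \<Rightarrow> real) \<Rightarrow> nat \<Rightarrow> real" where
  "average f N = (\<Sum>n=1..N. f n) / real N"

definition has_mean :: "(nat \<Rightarrow> real) \<Rightarrow> real \<Rightarrow> bool" where
  "has_mean f c \<longleftrightarrow> average f \<longlonglongrightarrow> c"

lemma has_mean_unique: "has_mean f a \<Longrightarrow> has_mean f b \<Longrightarrow> a = b"
  unfolding has_mean_def by (rule LIMSEQ_unique)

lemma has_mean_const: "has_mean (\<lambda>_. a) a"
proof -
  have "eventually (\<lambda>N. average (\<lambda>_. a) N = a) sequentially"
    using eventually_gt_at_top[of 0] by eventually_elim (simp add: average_def)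
  then show ?thesis
    unfolding has_mean_def by (rule tendsto_eventually)
qed

lemma has_mean_diff: "has_mean f a \<Longrightarrow> has_mean g b \<Longrightarrow> has_mean (\<lambda>n. f n - g n) (a - b)"
  unfolding has_mean_def average_def sum_subtractf diff_divide_distrib by (rule tendsto_diff)

lemma has_mean_sum:
  assumes "\<And>i. i \<in> I \<Longrightarrow> has_mean (f i) (a i)"
  shows "has_mean (\<lambda>n. \<Sum>i\<in>I. f i n) (\<Sum>i\<in>I. a i)"
proof -
  have "average (\<lambda>n. \<Sum>i\<in>I. f i n) = (\<lambda>N. \<Sum>i\<in>I. average (f i) N)"
    unfolding average_def by (subst sum.swap) (simp add: sum_divide_distrib)
  moreover have "(\<lambda>N. \<Sum>i\<in>I. average (f i) N) \<longlonglongrightarrow> (\<Sum>i\<in>I. a i)"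
    using assms unfolding has_mean_def by (intro tendsto_sum) auto
  ultimately show ?thesis
    unfolding has_mean_def by simp
qed

lemma has_mean_if_bounded_discrepancy:
  assumes "\<And>N. \<bar>(\<Sum>n=1..N. f n) - real N * c\<bar> \<le> B"
  shows "has_mean f c"
proof -
  have "(\<lambda>N. average f N - c) \<longlonglongrightarrow> 0"
  proof (rule tendsto_0_le[of "\<lambda>N. B / real N" _ _ 1])
    show "eventually (\<lambda>N. norm (average f N - c) \<le> norm (B / real N) * 1) sequentially"
      using eventually_gt_at_top[of 0]
    proof eventually_elim
      case (elim N)
      then have "average f N - c = ((\<Sum>n=1..N. f n) - real N * c) / real N"
        by (simp add: average_def field_simps)
      moreover have "\<bar>(\<Sum>n=1..N. f n) - real N * c\<bar> \<le> \<bar>B\<bar>"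
        using assms[of N] by linarith
      ultimately show ?case
        by (simp add: divide_right_mono)
    qed
    show "(\<lambda>N. B / real N) \<longlonglongrightarrow> 0"
      by (rule lim_const_over_n)
  qed
  then show ?thesis
    unfolding has_mean_def by (rule LIM_zero_cancel)
qed

text \<open>
  Shifting the argument by one changes each partial sum only by its two boundary terms.
\<close>

lemma has_mean_shift:
  assumes "has_mean f c" and bound: "\<And>n. \<bar>f n\<bar> \<le> 1"
  shows "has_mean (\<lambda>n. f (n + h)) c"
proof (induction h)
  case 0
  then show ?case using assms(1) by simp
next
  case (Suc h)
  have "has_mean (\<lambda>n. f (n + h) - f (n + Suc h)) 0"
  proof (rule has_mean_if_bounded_discrepancy)
    fix N
    have "(\<Sum>n=1..N. f (n + h) - f (n + Suc h)) = f (1 + h) - f (N + 1 + h)"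
      by (induction N) auto
    then show "\<bar>(\<Sum>n=1..N. f (n + h) - f (n + Suc h)) - real N * 0\<bar> \<le> 2"
      using bound[of "1 + h"] bound[of "N + 1 + h"] by linarith
  qed
  from has_mean_diff[OF Suc.IH this] show ?case
    by simp
qed

text \<open>
  The interchange of two limits: the means \<open>c k\<close> form a Cauchy sequence because
  \<open>\<bar>c k - c l\<bar> \<le> e k + e l\<close>, and their limit is the mean of \<open>f\<close> because the approximation is
  uniform in the length of the average.
\<close>

lemma has_mean_uniform_limit:
  assumes g: "\<And>k. has_mean (g k) (c k)"
    and close: "\<And>k N. N > 0 \<Longrightarrow> \<bar>average f N - average (g k) N\<bar> \<le> e k"
    and e: "e \<longlonglongrightarrow> 0"
  obtains m where "c \<longlonglongrightarrow> m" and "has_mean f m"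
proof -
  have c_close: "\<bar>c k - c l\<bar> \<le> e k + e l" for k l
  proof (rule LIMSEQ_le_const2)
    show "(\<lambda>N. \<bar>average (g k) N - average (g l) N\<bar>) \<longlonglongrightarrow> \<bar>c k - c l\<bar>"
      using g unfolding has_mean_def by (intro tendsto_intros) auto
    have "\<bar>average (g k) N - average (g l) N\<bar> \<le> e k + e l" if "N \<ge> 1" for N
      using close[of N k] close[of N l] that by linarith
    then show "\<exists>M. \<forall>N\<ge>M. \<bar>average (g k) N - average (g l) N\<bar> \<le> e k + e l"
      by blast
  qed
  have small_e: "\<exists>M. \<forall>k\<ge>M. e k < r" if "r > 0" for r
    using order_tendstoD(2)[OF e that] by (simp add: eventually_sequentially)
  have "Cauchy c"
  proof (rule metric_CauchyI)
    fix r :: real assume "r > 0"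
    then obtain M where "\<forall>k\<ge>M. e k < r / 2"
      using small_e[of "r / 2"] by auto
    then have "dist (c k) (c l) < r" if "k \<ge> M" "l \<ge> M" for k l
      using c_close[of k l] that by (smt (verit) dist_real_def field_sum_of_halves)
    then show "\<exists>M. \<forall>k\<ge>M. \<forall>l\<ge>M. dist (c k) (c l) < r"
      by blast
  qed
  then obtain m where m: "c \<longlonglongrightarrow> m"
    by (auto simp: Cauchy_convergent_iff convergent_def)
  have m_close: "\<bar>c k - m\<bar> \<le> e k" for k
  proof (rule LIMSEQ_le)
    show "(\<lambda>l. \<bar>c k - c l\<bar>) \<longlonglongrightarrow> \<bar>c k - m\<bar>"
      by (intro tendsto_intros m)
    show "(\<lambda>l. e k + e l) \<longlonglongrightarrow> e k"
      using tendsto_add[OF tendsto_const e, of "e k"] by simp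
    show "\<exists>M. \<forall>l\<ge>M. \<bar>c k - c l\<bar> \<le> e k + e l"
      using c_close by blast
  qed
  have "average f \<longlonglongrightarrow> m"
  proof (rule metric_LIMSEQ_I)
    fix r :: real assume "r > 0"
    then obtain k where k: "e k < r / 3"
      using small_e[of "r / 3"] by auto
    obtain M where M: "\<forall>N\<ge>M. dist (average (g k) N) (c k) < r / 3"
      using metric_LIMSEQ_D[OF g[of k, unfolded has_mean_def], of "r / 3"] \<open>r > 0\<close> by auto
    have "dist (average f N) m < r" if "N \<ge> Suc M" for N
    proof -
      have "\<bar>average (g k) N - c k\<bar> < r / 3"
        using M that by (simp add: dist_real_def)
      then show ?thesis
        using close[of N k] m_close[of k] k that unfolding dist_real_def by linarith
    qed
    then show "\<exists>M. \<forall>N\<ge>M. dist (average f N) m < r"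
      by blast
  qed
  with m show thesis
    using that unfolding has_mean_def by blast
qed

text \<open>
  Each condition \<open>m dvd n + h\<close> holds for at most \<open>(N + C) / m\<close> of the numbers \<open>n \<le> N\<close>. The set \<open>D\<close>
  may be infinite, but only its finitely many elements up to \<open>N + C\<close> are relevant.
\<close>

lemma average_close_if_differ_on_multiples:
  assumes H: "finite H" "\<And>h. h \<in> H \<Longrightarrow> h \<le> C"
    and bound: "\<And>n. \<bar>f n\<bar> \<le> 1" "\<And>n. \<bar>g n\<bar> \<le> 1"
    and differ: "\<And>n. n \<ge> 1 \<Longrightarrow> f n \<noteq> g n \<Longrightarrow> \<exists>h\<in>H. \<exists>m\<in>D. m dvd n + h"
    and D: "0 \<notin> D" "\<And>E. finite E \<Longrightarrow> E \<subseteq> D \<Longrightarrow> (\<Sum>m\<in>E. 1 / real m) \<le> s"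
    and "N > 0"
  shows "\<bar>average f N - average g N\<bar> \<le> 2 * real (card H) * (1 + real C) * s"
proof -
  define E where "E = {m\<in>D. m \<le> N + C}"
  define B where "B h m = {n\<in>{1..N}. m dvd n + h}" for h m
  have fin: "finite E" "finite (B h m)" for h m
    by (auto simp: E_def B_def)
  have card_B: "real (card (B h m)) \<le> real (N + C) * (1 / real m)" if "h \<in> H" "m \<in> E" for h m
  proof -
    have "m > 0"
      using that D(1) by (auto simp: E_def intro!: Nat.gr0I)
    have "(\<lambda>n. (n + h) div m) ` B h m \<subseteq> {1..(N + C) div m}"
    proof safe
      fix n assume n: "n \<in> B h m"
      then obtain j where j: "n + h = m * j" "n \<ge> 1"
        by (auto simp: B_def)
      then have "j > 0"
        by (auto intro!: Nat.gr0I)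
      moreover have "(n + h) div m \<le> (N + C) div m"
        using n H(2)[OF that(1)] by (intro div_le_mono) (auto simp: B_def)
      ultimately show "(n + h) div m \<in> {1..(N + C) div m}"
        using j \<open>m > 0\<close> by simp
    qed
    moreover have "inj_on (\<lambda>n. (n + h) div m) (B h m)"
    proof (rule inj_onI)
      fix a b assume "a \<in> B h m" "b \<in> B h m" "(a + h) div m = (b + h) div m"
      then have "a + h = b + h"
        by (metis (no_types, lifting) B_def dvd_div_mult_self mem_Collect_eq)
      then show "a = b" by simp
    qed
    ultimately have "card (B h m) \<le> (N + C) div m"
      using card_inj_on_le[of "\<lambda>n. (n + h) div m" "B h m" "{1..(N + C) div m}"] by simp
    then have "real (card (B h m)) \<le> real ((N + C) div m)"
      by simp
    also have "\<dots> \<le> real (N + C) / real m"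
      by (rule of_nat_div_le_of_nat)
    finally show ?thesis by simp
  qed
  have s: "(\<Sum>m\<in>E. 1 / real m) \<le> s"
    by (rule D(2)) (auto simp: E_def)
  have "\<bar>\<Sum>n=1..N. f n - g n\<bar> \<le> (\<Sum>n=1..N. \<bar>f n - g n\<bar>)"
    by (rule sum_abs)
  also have "\<dots> = (\<Sum>n\<in>{n\<in>{1..N}. f n \<noteq> g n}. \<bar>f n - g n\<bar>)"
    by (rule sum.mono_neutral_right) auto
  also have "\<dots> \<le> of_nat (card {n\<in>{1..N}. f n \<noteq> g n}) * 2"
  proof (rule sum_bounded_above)
    fix n
    show "\<bar>f n - g n\<bar> \<le> 2"
      using bound[of n] by linarith
  qed
  also have "\<dots> \<le> real (\<Sum>h\<in>H. \<Sum>m\<in>E. card (B h m)) * 2"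
  proof -
    have "{n\<in>{1..N}. f n \<noteq> g n} \<subseteq> (\<Union>h\<in>H. \<Union>m\<in>E. B h m)"
    proof safe
      fix n assume n: "n \<in> {1..N}" "f n \<noteq> g n"
      then obtain h m where hm: "h \<in> H" "m \<in> D" "m dvd n + h"
        using differ[of n] by auto
      moreover have "m \<le> n + h"
        using dvd_imp_le[OF hm(3)] n by simp
      then have "m \<in> E"
        using n hm H(2)[of h] by (auto simp: E_def)
      ultimately show "n \<in> (\<Union>h\<in>H. \<Union>m\<in>E. B h m)"
        using n by (auto simp: B_def)
    qed
    then have "card {n\<in>{1..N}. f n \<noteq> g n} \<le> card (\<Union>h\<in>H. \<Union>m\<in>E. B h m)"
      using fin H(1) by (intro card_mono) auto
    also have "\<dots> \<le> (\<Sum>h\<in>H. card (\<Union>m\<in>E. B h m))"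
      using H(1) by (rule card_UN_le)
    also have "\<dots> \<le> (\<Sum>h\<in>H. \<Sum>m\<in>E. card (B h m))"
      using fin by (intro sum_mono card_UN_le)
    finally show ?thesis
      by (intro mult_right_mono of_nat_mono) auto
  qed
  also have "\<dots> \<le> (\<Sum>h\<in>H. \<Sum>m\<in>E. real (N + C) * (1 / real m)) * 2"
    unfolding of_nat_sum by (intro mult_right_mono sum_mono card_B) auto
  also have "\<dots> = 2 * real (card H) * real (N + C) * (\<Sum>m\<in>E. 1 / real m)"
    by (simp only: sum_distrib_left[symmetric] sum_constant) simp
  also have "\<dots> \<le> 2 * real (card H) * (real N * (1 + real C)) * s"
  proof (intro mult_mono s)
    have "real C \<le> real N * real C"
      using \<open>N > 0\<close> by (simp add: mult_le_cancel_right1)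
    then show "real (N + C) \<le> real N * (1 + real C)"
      by (simp add: distrib_left)
  qed (auto intro: sum_nonneg)
  finally have "\<bar>\<Sum>n=1..N. f n - g n\<bar> \<le> 2 * real (card H) * (real N * (1 + real C)) * s" .
  moreover have "\<bar>average f N - average g N\<bar> = \<bar>\<Sum>n=1..N. f n - g n\<bar> / real N"
    by (simp add: average_def sum_subtractf flip: diff_divide_distrib)
  ultimately show ?thesis
    using \<open>N > 0\<close> by (simp add: pos_divide_le_eq mult_ac)
qed

section \<open>Periodic functions\<close>

definition periodic :: "nat \<Rightarrow> (nat \<Rightarrow> 'a) \<Rightarrow> bool" where
  "periodic q f \<longleftrightarrow> q > 0 \<and> (\<forall>n. f (n + q) = f n)"

definition period_mean :: "nat \<Rightarrow> (nat \<Rightarrow> real) \<Rightarrow> real" where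
  "period_mean q f = (\<Sum>n<q. f n) / real q"

lemma periodic_add_mult: "periodic q f \<Longrightarrow> f (n + k * q) = f n"
proof (induction k)
  case (Suc k)
  have "f (n + Suc k * q) = f ((n + k * q) + q)"
    by (simp add: algebra_simps)
  with Suc show ?case
    by (simp add: periodic_def)
qed simp

lemma periodic_mod: "periodic q f \<Longrightarrow> f (n mod q) = f n"
  using periodic_add_mult[of q f "n mod q" "n div q"] by (simp add: add.commute)

lemma periodic_mult:
  fixes f g :: "nat \<Rightarrow> real"
  assumes "periodic q f" "periodic r g"
  shows "periodic (q * r) (\<lambda>n. f n * g n)"
proof -
  have "f (n + q * r) = f n" "g (n + q * r) = g n" for n
    using periodic_add_mult[OF assms(1), of n r] periodic_add_mult[OF assms(2), of n q]
    by (simp_all add: mult.commute)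
  then show ?thesis
    using assms by (simp add: periodic_def)
qed

text \<open>
  The discrepancy \<open>(\<Sum>n=1..N. f n) - N * period_mean q f\<close> is itself periodic in \<open>N\<close>, because every
  \<open>q\<close> consecutive values of \<open>f\<close> have the same sum; hence it is bounded.
\<close>

lemma periodic_has_mean:
  assumes "periodic q f"
  shows "has_mean f (period_mean q f)"
proof -
  define R where "R N = (\<Sum>n=1..N. f n) - real N * period_mean q f" for N
  have "q > 0"
    using assms by (simp add: periodic_def)
  have window: "(\<Sum>i<q. f (N + i)) = (\<Sum>i<q. f i)" for N
  proof (induction N)
    case (Suc N)
    have "f N + (\<Sum>i<q. f (Suc N + i)) = (\<Sum>i<Suc q. f (N + i))"
      by (subst sum.lessThan_Suc_shift) simp
    also have "\<dots> = (\<Sum>i<q. f (N + i)) + f N"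
      using assms by (simp add: periodic_def)
    finally show ?case
      using Suc by simp
  qed simp
  have sum_split: "(\<Sum>n=1..N + k. f n) = (\<Sum>n=1..N. f n) + (\<Sum>i<k. f (Suc N + i))" for N k
    by (induction k) auto
  have "periodic q R"
    unfolding periodic_def R_def sum_split window
    using \<open>q > 0\<close> by (simp add: period_mean_def field_simps)
  then have "R N = R (N mod q)" for N
    by (simp add: periodic_mod)
  moreover have "\<bar>R (N mod q)\<bar> \<le> (\<Sum>i<q. \<bar>R i\<bar>)" for N
    using \<open>q > 0\<close> member_le_sum[of "N mod q" "{..<q}" "\<lambda>i. \<bar>R i\<bar>"] by simp
  ultimately have "\<bar>R N\<bar> \<le> (\<Sum>i<q. \<bar>R i\<bar>)" for N
    by metis
  then show ?thesis
    unfolding R_def by (rule has_mean_if_bounded_discrepancy)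
qed

text \<open>
  By the Chinese remainder theorem the residues modulo coprime \<open>q\<close> and \<open>r\<close> are independent and
  uniformly distributed over a period \<open>q * r\<close>.
\<close>

lemma period_mean_mult:
  assumes f: "periodic q f" and g: "periodic r g" and "coprime q r"
  shows "period_mean (q * r) (\<lambda>n. f n * g n) = period_mean q f * period_mean r g"
proof -
  have "q > 0" "r > 0"
    using f g by (auto simp: periodic_def)
  let ?\<phi> = "\<lambda>n. (n mod q, n mod r)"
  have inj: "inj_on ?\<phi> {..<q * r}"
  proof (rule inj_onI)
    fix a b assume "a \<in> {..<q * r}" "b \<in> {..<q * r}" "?\<phi> a = ?\<phi> b"
    then have "[a = b] (mod q * r)"
      using \<open>coprime q r\<close> by (intro coprime_cong_mult_nat) (auto simp: cong_def)
    then show "a = b"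
      using \<open>a \<in> _\<close> \<open>b \<in> _\<close> by (simp add: cong_def)
  qed
  have "?\<phi> ` {..<q * r} = {..<q} \<times> {..<r}"
  proof (rule card_subset_eq)
    show "?\<phi> ` {..<q * r} \<subseteq> {..<q} \<times> {..<r}"
      using \<open>q > 0\<close> \<open>r > 0\<close> by auto
    show "card (?\<phi> ` {..<q * r}) = card ({..<q} \<times> {..<r})"
      using inj by (simp add: card_image card_cartesian_product)
  qed simp
  then have "(\<Sum>(i, j)\<in>{..<q} \<times> {..<r}. f i * g j) = (\<Sum>n<q * r. f (n mod q) * g (n mod r))"
    using sum.reindex[OF inj, of "\<lambda>(i, j). f i * g j"] by (simp add: o_def)
  then have "(\<Sum>n<q * r. f n * g n) = (\<Sum>i<q. f i) * (\<Sum>j<r. g j)"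
    by (simp add: periodic_mod[OF f] periodic_mod[OF g] sum_product sum.cartesian_product)
  then show ?thesis
    by (simp add: period_mean_def)
qed

lemma periodic_mult_has_mean:
  assumes "finite F" "\<And>i. i \<in> F \<Longrightarrow> periodic (q i) (f i)"
    and "pairwise (\<lambda>i j. coprime (q i) (q j)) F"
  shows "has_mean (\<lambda>n. \<Prod>i\<in>F. f i n) (\<Prod>i\<in>F. period_mean (q i) (f i))"
proof -
  have "periodic (\<Prod>i\<in>F. q i) (\<lambda>n. \<Prod>i\<in>F. f i n) \<and>
      period_mean (\<Prod>i\<in>F. q i) (\<lambda>n. \<Prod>i\<in>F. f i n) = (\<Prod>i\<in>F. period_mean (q i) (f i))"
    using assms
  proof (induction F rule: finite_induct)
    case empty
    then show ?case by (simp add: periodic_def period_mean_def)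
  next
    case (insert j F)
    have IH: "periodic (\<Prod>i\<in>F. q i) (\<lambda>n. \<Prod>i\<in>F. f i n)"
      "period_mean (\<Prod>i\<in>F. q i) (\<lambda>n. \<Prod>i\<in>F. f i n) = (\<Prod>i\<in>F. period_mean (q i) (f i))"
      using insert.IH insert.prems by (auto simp: pairwise_insert)
    have "coprime (q j) (\<Prod>i\<in>F. q i)"
      using insert.prems(2) insert.hyps(2) by (intro prod_coprime_right) (auto simp: pairwise_def)
    moreover have "periodic (q j) (f j)"
      using insert.prems(1) by simp
    ultimately show ?case
      using IH insert.hyps periodic_mult[of "q j" "f j"] period_mean_mult[of "q j" "f j"]
      by simp
  qed
  then show ?thesis
    using periodic_has_mean by metis
qed

section \<open>Correlations for finite sets of primes\<close>

lemma lambda_eq_prod_singletons: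
  assumes "finite F"
  shows "lambda F n = (\<Prod>p\<in>F. lambda {p} n)"
  using assms
proof (induction F rule: finite_induct)
  case empty
  then show ?case by (simp add: lambda_def)
next
  case (insert q F)
  have "lambda (insert q F) n = lambda {q} n * lambda F n"
    unfolding lambda_def prod_mset.distrib[symmetric]
    using insert.hyps by (intro arg_cong[where f = prod_mset] image_mset_cong) auto
  with insert show ?case by simp
qed

lemma lambda_eq_if_no_new_divisor:
  assumes "n \<ge> 1" "Q \<subseteq> P" "\<And>p. p \<in> P - Q \<Longrightarrow> \<not> p dvd n"
  shows "lambda P n = lambda Q n"
  unfolding lambda_def using assms
  by (intro arg_cong[where f = prod_mset] image_mset_cong) (auto simp: prime_factors_dvd)

lemma lambda_singleton:
  assumes "prime p"
  shows "lambda {p} n = (-1) ^ multiplicity p n"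
proof -
  have "(\<Prod>x\<in>#M. if x \<in> {p} then -1 else 1) = (-1 :: int) ^ count M p" for M
    by (induction M) auto
  then show ?thesis
    unfolding lambda_def using assms by (simp only: count_prime_factorization_prime)
qed

lemma abs_Lambda: "\<bar>real_of_int (Lambda P H n)\<bar> = 1"
proof -
  have "\<bar>lambda P m\<bar> = 1" for m
    using lambda_values[of P m] by auto
  then have "\<bar>Lambda P H n\<bar> = 1"
    by (simp add: Lambda_def abs_prod)
  then show ?thesis
    by (metis of_int_1 of_int_abs)
qed

lemma Lambda_eq_prod_singletons:
  assumes "finite F"
  shows "Lambda F H n = (\<Prod>p\<in>F. Lambda {p} H n)"
  unfolding Lambda_def lambda_eq_prod_singletons[OF assms] by (rule prod.swap)

text \<open>
  On the multiples of \<open>p ^ K\<close>, where the sign is not determined by the residue modulo \<open>p ^ K\<close>, it is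
  replaced by 1; any other constant of absolute value 1 would serve equally well.
\<close>

definition truncated_Lambda :: "nat \<Rightarrow> nat \<Rightarrow> nat set \<Rightarrow> nat \<Rightarrow> real" where
  "truncated_Lambda p K H n =
    (\<Prod>h\<in>H. if p ^ K dvd n + h then 1 else real_of_int (lambda {p} (n + h)))"

lemma abs_truncated_Lambda: "\<bar>truncated_Lambda p K H n\<bar> = 1"
proof -
  have "\<bar>real_of_int (lambda {p} m)\<bar> = 1" for m
    using lambda_values[of "{p}" m] by auto
  then show ?thesis
    unfolding truncated_Lambda_def abs_prod by (intro prod.neutral) auto
qed

lemma periodic_truncated_Lambda:
  assumes "prime p"
  shows "periodic (p ^ K) (truncated_Lambda p K H)"
proof -
  have "lambda {p} (n + p ^ K) = lambda {p} n" if "\<not> p ^ K dvd n" for n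
  proof -
    have "n \<noteq> 0"
      using that by (intro notI) simp
    have not_unit: "\<not> is_unit p"
      using assms by (metis not_prime_unit)
    define v where "v = multiplicity p n"
    have "v < K"
      using that multiplicity_dvd'[of K p n] by (auto simp: v_def not_less[symmetric])
    have v: "p ^ v dvd n" "\<not> p ^ Suc v dvd n"
      using \<open>n \<noteq> 0\<close> not_unit
      by (auto simp: v_def multiplicity_dvd power_dvd_iff_le_multiplicity simp del: power_Suc)
    have "p ^ v dvd p ^ K" "p ^ Suc v dvd p ^ K"
      using \<open>v < K\<close> by (simp_all add: le_imp_power_dvd del: power_Suc)
    then have "p ^ v dvd n + p ^ K" "\<not> p ^ Suc v dvd n + p ^ K"
      using v by (auto simp: dvd_add_left_iff simp del: power_Suc)
    then have "multiplicity p (n + p ^ K) = v"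
      by (rule multiplicity_eqI)
    then show ?thesis
      using assms by (simp add: lambda_singleton v_def)
  qed
  then have step: "lambda {p} (n + h + p ^ K) = lambda {p} (n + h)" if "\<not> p ^ K dvd n + h" for n h
    using that by blast
  have "(if p ^ K dvd n + p ^ K + h then 1 else real_of_int (lambda {p} (n + p ^ K + h))) =
      (if p ^ K dvd n + h then 1 else real_of_int (lambda {p} (n + h)))" for n h
  proof -
    have "n + p ^ K + h = n + h + p ^ K"
      by simp
    then show ?thesis
      using step[of n h] by (auto simp only: dvd_add_left_iff dvd_refl split: if_split)
  qed
  then show ?thesis
    using assms prime_gt_0_nat unfolding periodic_def truncated_Lambda_def by simp
qed

text \<open>
  Truncation makes the correlation periodic; it is undone by letting \<open>K\<close> tend to infinity, at the
  cost of an error proportional to \<open>\<Sum>p\<in>F. 1 / p ^ K\<close>.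
\<close>

lemma finite_Lambda_has_mean_limit:
  assumes "finite H" "finite F" "\<And>p. p \<in> F \<Longrightarrow> prime p"
  shows "\<exists>m. (\<lambda>K. \<Prod>p\<in>F. period_mean (p ^ K) (truncated_Lambda p K H)) \<longlonglongrightarrow> m \<and>
    has_mean (\<lambda>n. real_of_int (Lambda F H n)) m"
proof -
  obtain C where C: "\<And>h. h \<in> H \<Longrightarrow> h \<le> C"
    using assms(1) by (metis finite_nat_set_iff_bounded_le)
  define s where "s K = (\<Sum>p\<in>F. 1 / real (p ^ K))" for K
  define e where "e K = 2 * real (card H) * (1 + real C) * s K" for K
  show ?thesis
  proof (rule has_mean_uniform_limit)
    show "has_mean (\<lambda>n. \<Prod>p\<in>F. truncated_Lambda p K H n)
        (\<Prod>p\<in>F. period_mean (p ^ K) (truncated_Lambda p K H))" for K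
      using assms periodic_truncated_Lambda
      by (intro periodic_mult_has_mean)
        (auto simp: pairwise_def primes_coprime intro!: coprime_power_left_iff[THEN iffD2]
          coprime_power_right_iff[THEN iffD2])
    have "s \<longlonglongrightarrow> (\<Sum>p\<in>F. 0)"
      unfolding s_def
    proof (rule tendsto_sum)
      fix p assume "p \<in> F"
      then have "1 < real p"
        using assms(3) prime_gt_1_nat by simp
      then show "(\<lambda>K. 1 / real (p ^ K)) \<longlonglongrightarrow> 0"
        using LIMSEQ_inverse_realpow_zero[of "real p"] by (simp add: inverse_eq_divide)
    qed
    from tendsto_mult_right_zero[of s _ "2 * real (card H) * (1 + real C)"] this
    show "e \<longlonglongrightarrow> 0"
      unfolding e_def by simp
    fix K N :: nat assume "N > 0"
    show "\<bar>average (\<lambda>n. real_of_int (Lambda F H n)) N -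
        average (\<lambda>n. \<Prod>p\<in>F. truncated_Lambda p K H n) N\<bar> \<le> e K"
      unfolding e_def
    proof (rule average_close_if_differ_on_multiples[OF assms(1) C _ _ _ _ _ \<open>N > 0\<close>])
      show "\<bar>real_of_int (Lambda F H n)\<bar> \<le> 1" for n
        by (simp add: abs_Lambda)
      show "\<bar>\<Prod>p\<in>F. truncated_Lambda p K H n\<bar> \<le> 1" for n
        by (simp add: abs_prod abs_truncated_Lambda)
      show "\<exists>h\<in>H. \<exists>m\<in>(\<lambda>p. p ^ K) ` F. m dvd n + h"
        if "real_of_int (Lambda F H n) \<noteq> (\<Prod>p\<in>F. truncated_Lambda p K H n)" for n
      proof (rule ccontr)
        assume *: "\<not> ?thesis"
        have "(\<Prod>p\<in>F. truncated_Lambda p K H n) = (\<Prod>p\<in>F. real_of_int (Lambda {p} H n))"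
          unfolding truncated_Lambda_def Lambda_def of_int_prod using *
          by (intro prod.cong) auto
        then show False
          using that by (simp add: Lambda_eq_prod_singletons[OF assms(2), of H])
      qed
      show "0 \<notin> (\<lambda>p. p ^ K) ` F"
        using assms(3)[of 0] by auto
      fix E assume E: "finite E" "E \<subseteq> (\<lambda>p. p ^ K) ` F"
      then have "(\<Sum>m\<in>E. 1 / real m) \<le> (\<Sum>m\<in>(\<lambda>p. p ^ K) ` F. 1 / real m)"
        using assms(2) by (intro sum_mono2) auto
      also have "\<dots> \<le> s K"
        unfolding s_def using sum_image_le[OF assms(2), of "\<lambda>m. 1 / real m" "\<lambda>p. p ^ K"] by simp
      finally show "(\<Sum>m\<in>E. 1 / real m) \<le> s K" .
    qed
  qed blast
qed

text \<open>
  The means of the truncated correlations for single primes tend to \<open>\<kappa> p\<close>, by the case \<open>F = {p}\<close> of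
  the previous result. The limit of their product is thus identified.
\<close>

lemma finite_Lambda_has_mean:
  assumes "finite H" "finite F" "\<And>p. p \<in> F \<Longrightarrow> prime p"
    and \<kappa>: "\<And>p. prime p \<Longrightarrow> has_mean (\<lambda>n. real_of_int (Lambda {p} H n)) (\<kappa> p)"
  shows "has_mean (\<lambda>n. real_of_int (Lambda F H n)) (\<Prod>p\<in>F. \<kappa> p)"
proof -
  have "(\<lambda>K. period_mean (p ^ K) (truncated_Lambda p K H)) \<longlonglongrightarrow> \<kappa> p" if p: "prime p" for p
  proof -
    obtain m where lim: "(\<lambda>K. period_mean (p ^ K) (truncated_Lambda p K H)) \<longlonglongrightarrow> m"
      and m: "has_mean (\<lambda>n. real_of_int (Lambda {p} H n)) m"
      using finite_Lambda_has_mean_limit[of H "{p}"] assms(1) p by auto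
    then show ?thesis
      using has_mean_unique[OF m \<kappa>[OF p]] by simp
  qed
  then have lim: "(\<lambda>K. \<Prod>p\<in>F. period_mean (p ^ K) (truncated_Lambda p K H)) \<longlonglongrightarrow> (\<Prod>p\<in>F. \<kappa> p)"
    using assms(3) by (intro tendsto_prod) auto
  obtain m where "(\<lambda>K. \<Prod>p\<in>F. period_mean (p ^ K) (truncated_Lambda p K H)) \<longlonglongrightarrow> m"
    and "has_mean (\<lambda>n. real_of_int (Lambda F H n)) m"
    using finite_Lambda_has_mean_limit assms(1-3) by blast
  with lim show ?thesis
    using LIMSEQ_unique by blast
qed

section \<open>Small sets of primes\<close>

lemma small_reciprocal_tails:
  assumes "small P"
  obtains s where "s \<longlonglongrightarrow> 0"
    and "\<And>T E. finite E \<Longrightarrow> E \<subseteq> {p\<in>P. T < p} \<Longrightarrow> (\<Sum>m\<in>E. 1 / real m) \<le> s T"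
proof -
  define u where "u n = (if n \<in> P then 1 / real n else 0)" for n :: nat
  define s where "s T = suminf u - (\<Sum>n<Suc T. u n)" for T
  have "u summable_on UNIV"
    using assms unfolding small_def
    by (rule summable_on_cong_neutral[THEN iffD1, rotated 3]) (auto simp: u_def)
  then have u: "summable u"
    by (rule summable_on_imp_summable)
  have "(\<lambda>T. \<Sum>n<Suc T. u n) \<longlonglongrightarrow> suminf u"
    using LIMSEQ_Suc[OF summable_LIMSEQ[OF u]] .
  then have "s \<longlonglongrightarrow> suminf u - suminf u"
    unfolding s_def by (intro tendsto_intros)
  moreover have "(\<Sum>m\<in>E. 1 / real m) \<le> s T" if "finite E" "E \<subseteq> {p\<in>P. T < p}" for T E
  proof -
    have "(\<Sum>m\<in>E. 1 / real m) + (\<Sum>n<Suc T. u n) = (\<Sum>m\<in>E. u m) + (\<Sum>n<Suc T. u n)"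
      using that by (auto simp: u_def intro!: sum.cong)
    also have "\<dots> = (\<Sum>n\<in>E \<union> {..<Suc T}. u n)"
      using that by (intro sum.union_disjoint[symmetric]) auto
    also have "\<dots> \<le> suminf u"
      using that by (intro sum_le_suminf u) (auto simp: u_def)
    finally show ?thesis
      by (simp add: s_def)
  qed
  ultimately show thesis
    using that[of s] by simp
qed

text \<open>
  The correlations for the finite sets \<open>{p \<in> P. p \<le> T}\<close> approximate that for \<open>P\<close> uniformly, because
  they differ only where a prime of \<open>P\<close> above \<open>T\<close> divides some \<open>n + h\<close>.
\<close>

lemma small_Lambda_has_mean:
  assumes "finite H" "\<And>p. p \<in> P \<Longrightarrow> prime p" "small P"
    and \<kappa>: "\<And>p. prime p \<Longrightarrow> has_mean (\<lambda>n. real_of_int (Lambda {p} H n)) (\<kappa> p)"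
  obtains m where "(\<lambda>T. \<Prod>p | p \<in> P \<and> p \<le> T. \<kappa> p) \<longlonglongrightarrow> m"
    and "has_mean (\<lambda>n. real_of_int (Lambda P H n)) m"
proof -
  obtain C where C: "\<And>h. h \<in> H \<Longrightarrow> h \<le> C"
    using assms(1) by (metis finite_nat_set_iff_bounded_le)
  obtain s where s: "s \<longlonglongrightarrow> 0"
    "\<And>T E. finite E \<Longrightarrow> E \<subseteq> {p\<in>P. T < p} \<Longrightarrow> (\<Sum>m\<in>E. 1 / real m) \<le> s T"
    using small_reciprocal_tails[OF assms(3)] by blast
  define e where "e T = 2 * real (card H) * (1 + real C) * s T" for T
  show thesis
  proof (rule has_mean_uniform_limit)
    show "has_mean (\<lambda>n. real_of_int (Lambda {p. p \<in> P \<and> p \<le> T} H n))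
        (\<Prod>p | p \<in> P \<and> p \<le> T. \<kappa> p)" for T
      using assms(1,2) \<kappa> by (intro finite_Lambda_has_mean) auto
    show "e \<longlonglongrightarrow> 0"
      unfolding e_def by (rule tendsto_mult_right_zero[OF s(1)])
    fix T N :: nat assume "N > 0"
    show "\<bar>average (\<lambda>n. real_of_int (Lambda P H n)) N -
        average (\<lambda>n. real_of_int (Lambda {p. p \<in> P \<and> p \<le> T} H n)) N\<bar> \<le> e T"
      unfolding e_def
    proof (rule average_close_if_differ_on_multiples[OF assms(1) C _ _ _ _ s(2) \<open>N > 0\<close>])
      show "\<exists>h\<in>H. \<exists>m\<in>{p \<in> P. T < p}. m dvd n + h"
        if "n \<ge> 1"
          "real_of_int (Lambda P H n) \<noteq> real_of_int (Lambda {p. p \<in> P \<and> p \<le> T} H n)" for n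
      proof (rule ccontr)
        assume *: "\<not> ?thesis"
        have "Lambda P H n = Lambda {p. p \<in> P \<and> p \<le> T} H n"
          unfolding Lambda_def using * that(1)
          by (intro prod.cong lambda_eq_if_no_new_divisor) (auto simp: not_le)
        with that(2) show False by simp
      qed
    qed (auto simp: abs_Lambda)
  qed (rule that)
qed

section \<open>Non-exceptional primes\<close>

text \<open>
  Among the numbers up to \<open>p * M\<close>, the \<open>p * M - M\<close> non-multiples of \<open>p\<close> have sign 1, and the
  multiples \<open>p * j\<close> have the sign opposite to that of \<open>j\<close>. Hence the mean \<open>c\<close> satisfies
  \<open>c = 1 - 1 / p - c / p\<close>.
\<close>

lemma lambda_singleton_has_mean:
  assumes "prime p"
  shows "has_mean (\<lambda>n. real_of_int (lambda {p} n)) (1 - 2 / (real p + 1))"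
proof -
  define l where "l n = real_of_int (lambda {p} n)" for n
  have "p > 0"
    using assms prime_gt_0_nat by simp
  \<comment> \<open>The mean exists by the general theory, applied to the single shift 0.\<close>
  obtain c where "has_mean (\<lambda>n. real_of_int (Lambda {p} {0} n)) c"
    using finite_Lambda_has_mean_limit[of "{0}" "{p}"] assms by auto
  then have c: "has_mean l c"
    by (simp add: Lambda_def l_def[abs_def])
  have block: "(\<Sum>n=1..p * M. l n) = real (p * M) - real M - (\<Sum>j=1..M. l j)" for M
  proof -
    let ?A = "(\<lambda>j. p * j) ` {1..M}"
    have A: "?A = {n\<in>{1..p * M}. p dvd n}"
      using \<open>p > 0\<close> by (auto elim!: dvdE intro!: Nat.gr0I)
    have inj: "inj_on (\<lambda>j. p * j) {1..M}"
      using \<open>p > 0\<close> by (auto intro: inj_onI)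
    have off: "l n = 1" if "n \<in> {1..p * M} - ?A" for n
    proof -
      have "\<not> p dvd n"
        using that unfolding A by auto
      then show ?thesis
        by (simp add: l_def lambda_singleton[OF assms] not_dvd_imp_multiplicity_0)
    qed
    have "l (p * j) = - l j" if "j \<ge> 1" for j
      using that \<open>p > 0\<close> lambda_mult[of p j "{p}"] lambda_prime[OF assms, of "{p}"]
      by (simp add: l_def)
    then have on: "(\<Sum>n\<in>?A. l n) = - (\<Sum>j=1..M. l j)"
      unfolding sum.reindex[OF inj] sum_negf[symmetric] by (intro sum.cong) auto
    have "?A \<subseteq> {1..p * M}"
      unfolding A by auto
    then have "(\<Sum>n=1..p * M. l n) = (\<Sum>n\<in>{1..p * M} - ?A. l n) + (\<Sum>n\<in>?A. l n)"
      by (intro sum.subset_diff) auto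
    moreover have "real (card ({1..p * M} - ?A)) = real (p * M) - real M"
      using \<open>?A \<subseteq> {1..p * M}\<close> inj card_mono[OF _ \<open>?A \<subseteq> {1..p * M}\<close>]
      by (subst card_Diff_subset) (auto simp: card_image of_nat_diff)
    ultimately show ?thesis
      using on off by simp
  qed
  have "(\<lambda>M. average l (p * M)) \<longlonglongrightarrow> c"
    using LIMSEQ_subseq_LIMSEQ[OF c[unfolded has_mean_def], of "\<lambda>M. p * M"] \<open>p > 0\<close>
    by (simp add: o_def strict_mono_def)
  moreover have "(\<lambda>M. average l (p * M)) \<longlonglongrightarrow> 1 - 1 / real p - c / real p"
  proof (rule Lim_transform_eventually)
    show "(\<lambda>M. 1 - 1 / real p - average l M / real p) \<longlonglongrightarrow> 1 - 1 / real p - c / real p"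
      using c unfolding has_mean_def by (intro tendsto_intros) (use \<open>p > 0\<close> in auto)
    show "eventually (\<lambda>M. 1 - 1 / real p - average l M / real p = average l (p * M)) sequentially"
      using eventually_gt_at_top[of 0]
    proof eventually_elim
      case (elim M)
      then show ?case
        unfolding average_def block using \<open>p > 0\<close> by (simp add: field_simps)
    qed
  qed
  ultimately have "c = 1 - 1 / real p - c / real p"
    by (rule LIMSEQ_unique)
  then have "c * (1 + 1 / real p) = 1 - 1 / real p"
    by (simp add: algebra_simps)
  then have "c * (real p + 1) = real p - 1"
    using \<open>p > 0\<close> by (simp add: field_simps)
  then have "c = 1 - 2 / (real p + 1)"
    by (simp add: field_simps)
  with c show ?thesis
    by (simp add: l_def[abs_def])
qed

text \<open>
  At most one factor of the correlation at a non-exceptional prime differs from 1, so that the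
  product of the factors \<open>1 - (1 - lambda {p} (n + h))\<close> expands without mixed terms.
\<close>

lemma nonexceptional_Lambda_eq_sum:
  assumes "finite H" "prime p" "\<not> exceptional H p"
  shows "Lambda {p} H n = 1 - (\<Sum>h\<in>H. 1 - lambda {p} (n + h))"
proof -
  have one: "lambda {p} m = 1" if "\<not> p dvd m" for m
    using that assms(2) by (simp add: lambda_singleton not_dvd_imp_multiplicity_0)
  show ?thesis
  proof (cases "\<exists>h\<in>H. p dvd n + h")
    case True
    then obtain h where h: "h \<in> H" "p dvd n + h"
      by blast
    have others: "lambda {p} (n + h') = 1" if "h' \<in> H - {h}" for h'
    proof (rule one, rule notI)
      assume "p dvd n + h'"
      then have "int p dvd int (n + h) - int (n + h')"
        using h(2) by (intro dvd_diff) (auto simp del: of_nat_add)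
      then have "int p dvd int h - int h'"
        by simp
      moreover have "int h - int h' \<in> differences H"
        using h(1) that by (auto simp: differences_def)
      ultimately show False
        using assms(2,3) by (auto simp: exceptional_def)
    qed
    then show ?thesis
      using h(1) assms(1) by (simp add: Lambda_def prod.remove[of H h] sum.remove[of H h])
  next
    case False
    then show ?thesis
      using one by (simp add: Lambda_def)
  qed
qed

lemma nonexceptional_Lambda_has_mean:
  assumes "finite H" "prime p" "\<not> exceptional H p"
  shows "has_mean (\<lambda>n. real_of_int (Lambda {p} H n)) (1 - 2 * (real (card H) / (real p + 1)))"
proof -
  have "\<bar>real_of_int (lambda {p} m)\<bar> \<le> 1" for m
    using lambda_values[of "{p}" m] by auto
  then have "has_mean (\<lambda>n. real_of_int (lambda {p} (n + h))) (1 - 2 / (real p + 1))" for h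
    by (rule has_mean_shift[OF lambda_singleton_has_mean[OF assms(2)]])
  then have "has_mean (\<lambda>n. 1 - (\<Sum>h\<in>H. 1 - real_of_int (lambda {p} (n + h))))
      (1 - (\<Sum>h\<in>H. 1 - (1 - 2 / (real p + 1))))"
    by (intro has_mean_diff has_mean_sum has_mean_const)
  then show ?thesis
    by (simp add: nonexceptional_Lambda_eq_sum[OF assms] mult.commute)
qed

section \<open>The mean value theorem for correlations\<close>

text \<open>
  For real \<open>x\<close>, the mean is the average over the first \<open>\<lfloor>x\<rfloor>\<close> positive integers times
  \<open>\<lfloor>x\<rfloor> / x\<close>, a factor that tends to 1.
\<close>

lemma mean_tendsto:
  assumes "has_mean (\<lambda>n. real_of_int (Lambda P H n)) m"
  shows "(mean P H \<longlongrightarrow> m) at_top"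
proof -
  let ?f = "\<lambda>n. real_of_int (Lambda P H n)"
  have "filterlim (\<lambda>x::real. nat \<lfloor>x\<rfloor>) sequentially at_top"
    by (intro filterlim_compose[OF filterlim_nat_sequentially] filterlim_floor_sequentially)
  then have "((\<lambda>x::real. average ?f (nat \<lfloor>x\<rfloor>)) \<longlongrightarrow> m) at_top"
    by (rule filterlim_compose[OF assms[unfolded has_mean_def]])
  moreover have "((\<lambda>x::real. real (nat \<lfloor>x\<rfloor>) / x) \<longlongrightarrow> 1) at_top"
  proof (rule tendsto_sandwich)
    show "eventually (\<lambda>x::real. 1 - 1 / x \<le> real (nat \<lfloor>x\<rfloor>) / x) at_top"
      using eventually_ge_at_top[of 1]
    proof eventually_elim
      case (elim x)
      then have "x - 1 \<le> real (nat \<lfloor>x\<rfloor>)" by linarith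
      then have "(x - 1) / x \<le> real (nat \<lfloor>x\<rfloor>) / x"
        using elim by (intro divide_right_mono) auto
      then show ?case using elim by (simp add: diff_divide_distrib)
    qed
    show "eventually (\<lambda>x::real. real (nat \<lfloor>x\<rfloor>) / x \<le> 1) at_top"
      using eventually_ge_at_top[of 1]
    proof eventually_elim
      case (elim x)
      then have "real (nat \<lfloor>x\<rfloor>) \<le> x" by linarith
      then show ?case using elim by simp
    qed
    have "((\<lambda>x::real. 1 - 1 / x) \<longlongrightarrow> 1 - 0) at_top"
      by (intro tendsto_diff tendsto_const tendsto_divide_0[OF tendsto_const]
          filterlim_at_top_imp_at_infinity filterlim_ident)
    then show "((\<lambda>x::real. 1 - 1 / x) \<longlongrightarrow> 1) at_top" by simp
  qed (rule tendsto_const)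
  ultimately have "((\<lambda>x. real (nat \<lfloor>x\<rfloor>) / x * average ?f (nat \<lfloor>x\<rfloor>)) \<longlongrightarrow> 1 * m) at_top"
    by (intro tendsto_mult)
  moreover have "eventually
      (\<lambda>x. real (nat \<lfloor>x\<rfloor>) / x * average ?f (nat \<lfloor>x\<rfloor>) = mean P H x) at_top"
    using eventually_ge_at_top[of 1]
  proof eventually_elim
    case (elim x)
    then have "{n. 1 \<le> n \<and> real n \<le> x} = {1..nat \<lfloor>x\<rfloor>}" and "nat \<lfloor>x\<rfloor> > 0"
      by (auto simp: le_nat_iff le_floor_iff)
    then show ?case
      by (simp add: mean_def average_def)
  qed
  ultimately show ?thesis
    using Lim_transform_eventually by fastforce
qed

theorem theorem1:
  fixes H :: "nat set"
  assumes "finite H" and "\<forall>h\<in>H. h \<ge> 1"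
  shows "\<exists>\<eta> :: nat \<Rightarrow> real.
    (\<forall>P. (\<forall>p\<in>P. prime p) \<and> small P \<longrightarrow>
        (mean P H \<longlongrightarrow> kappa P H) at_top \<and>
        product_over P (\<lambda>p. 1 - 2 * \<eta> p) (kappa P H)) \<and>
    (\<forall>p. prime p \<and> \<not> exceptional H p \<longrightarrow> \<eta> p = real (card H) / (real p + 1))"
proof -
  have "\<exists>c. has_mean (\<lambda>n. real_of_int (Lambda {p} H n)) c" if "prime p" for p
    using finite_Lambda_has_mean_limit[of H "{p}"] assms(1) that by auto
  then obtain \<kappa> where \<kappa>: "\<And>p. prime p \<Longrightarrow> has_mean (\<lambda>n. real_of_int (Lambda {p} H n)) (\<kappa> p)"
    by metis
  define \<eta> where "\<eta> p = (1 - \<kappa> p) / 2" for p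
  have \<kappa>_eq: "1 - 2 * \<eta> p = \<kappa> p" for p
    by (simp add: \<eta>_def field_simps)
  have "(mean P H \<longlongrightarrow> kappa P H) at_top \<and> product_over P (\<lambda>p. 1 - 2 * \<eta> p) (kappa P H)"
    if P: "\<forall>p\<in>P. prime p" "small P" for P
  proof -
    obtain m where prod: "(\<lambda>T. \<Prod>p | p \<in> P \<and> p \<le> T. \<kappa> p) \<longlonglongrightarrow> m"
      and "has_mean (\<lambda>n. real_of_int (Lambda P H n)) m"
      using small_Lambda_has_mean[of H P \<kappa>] assms(1) P \<kappa> by blast
    then have lim: "(mean P H \<longlongrightarrow> m) at_top"
      by (intro mean_tendsto)
    then have "kappa P H = m"
      unfolding kappa_def by (intro tendsto_Lim) auto
    with lim prod show ?thesis
      by (simp add: product_over_def \<kappa>_eq)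
  qed
  moreover have "\<eta> p = real (card H) / (real p + 1)" if "prime p" "\<not> exceptional H p" for p
    using has_mean_unique[OF \<kappa>[OF that(1)] nonexceptional_Lambda_has_mean[OF assms(1) that]]
    by (simp add: \<eta>_def del: divide_divide_eq_left)
  ultimately show ?thesis
    by blast
qed

end
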